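(* Let $\kappa$ be an infinite regular cardinal with $2^{<\kappa}>\kappa$, and let $T$ be a $(2^{<\kappa})$-special tree. Then $T\not\to(\kappa)^2_2$; that is, there is a colouring $c:[T]^2\to 2$ with no chain of order type $\kappa$ on which $c$ is constant.
   Context: A tree is a partial order in which the predecessors of each node are well-ordered. For a cardinal $\mu$, $T$ is $\mu$-special if it is a union of at most $\mu$ antichains. $2^{<\kappa}=\sup_{\mu<\kappa}2^\mu$ over cardinals $\mu<\kappa$. $[T]^2$ is the set of two-element chains of $T$. *)

theory Defs
  imports Main
begin

text \<open>
  Cardinals are those of the library: a cardinal is a relation \<open>r\<close> with
  \<^term>\<open>Card_order r\<close>, i.e. an initial well-order on its field, so it also serves as the
  corresponding initial ordinal. Ordinals and cardinals on different types are compared by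
  \<open>\<le>o\<close>, \<open><o\<close> and \<open>=o\<close>.
\<close>

unbundle cardinal_syntax

text \<open>
  \<open>s\<close> is the supremum of the cardinals in \<open>R\<close>. Competing upper bounds range over the
  type of \<open>s\<close> only; by \<open>is_card_sup_least\<close> below this is no restriction.
\<close>

definition is_card_sup :: "'b rel set \<Rightarrow> 'c rel \<Rightarrow> bool" where
  "is_card_sup R s \<longleftrightarrow>
     Card_order s \<and> (\<forall>r\<in>R. r \<le>o s) \<and>
     (\<forall>s' :: 'c rel. Card_order s' \<and> (\<forall>r\<in>R. r \<le>o s') \<longrightarrow> s \<le>o s')"

lemma is_card_sup_least:
  fixes s :: "'c rel" and s' :: "'d rel"
  assumes s: "is_card_sup R s" and s': "Card_order s'" "\<forall>r\<in>R. r \<le>o s'"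
  shows "s \<le>o s'"
proof (rule ccontr)
  assume "\<not> s \<le>o s'"
  moreover have "Card_order s"
    using s unfolding is_card_sup_def by (rule conjunct1)
  ultimately have "s' <o s"
    using not_ordLeq_iff_ordLess[of s' s] s'(1) card_order_on_well_order_on by metis
  then obtain p :: "'c rel" where p: "s' =o p" "p <o s"
    unfolding internalize_ordLess[of s' s] by (elim exE conjE)
  have "Card_order p"
    by (rule Card_order_ordIso2[OF s'(1) p(1)])
  moreover have "\<forall>r\<in>R. r \<le>o p"
  proof
    fix r assume "r \<in> R"
    with s'(2) have "r \<le>o s'" by (rule bspec)
    then show "r \<le>o p" using p(1) by (rule ordLeq_ordIso_trans)
  qed
  ultimately have "s \<le>o p"
    using s by (simp add: is_card_sup_def)
  with p(2) show False
    by (rule not_ordLess_ordLeq[THEN notE])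
qed

text \<open>
  The family of the cardinals \<open>2\<^sup>\<mu>\<close>, for cardinals \<open>\<mu> < \<kappa>\<close>; every
  such \<open>\<mu>\<close> has a representative on the type of \<open>\<kappa>\<close>.
\<close>

definition powers_below :: "'k rel \<Rightarrow> ('k \<Rightarrow> bool) rel set" where
  "powers_below \<kappa> =
     {ctwo ^c \<mu> |\<mu> :: 'k rel. Card_order \<mu> \<and> \<mu> <o \<kappa>}"

text \<open>The cardinal \<open>2\<^bsup><\<kappa>\<^esup>\<close>, determined up to \<open>=o\<close>.\<close>

definition weak_power :: "'k rel \<Rightarrow> ('k \<Rightarrow> bool) rel" where
  "weak_power \<kappa> = (SOME s. is_card_sup (powers_below \<kappa>) s)"

lemma is_card_sup_weak_power:
  fixes \<kappa> :: "'k rel"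
  shows "is_card_sup (powers_below \<kappa>) (weak_power \<kappa>)"
proof -
  let ?U = "{s :: ('k \<Rightarrow> bool) rel. Card_order s \<and> (\<forall>r\<in>powers_below \<kappa>. r \<le>o s)}"
  have "r \<le>o |UNIV :: ('k \<Rightarrow> bool) set|" if "r \<in> powers_below \<kappa>" for r
    using that unfolding powers_below_def BNF_Cardinal_Arithmetic.cexp_def
    by (elim CollectE exE conjE) (simp only: card_of_mono1[OF subset_UNIV])
  then have "|UNIV :: ('k \<Rightarrow> bool) set| \<in> ?U"
    by (simp add: card_of_Card_order)
  then obtain s where s: "s \<in> ?U" "\<And>t. (t, s) \<in> ordLess \<Longrightarrow> t \<notin> ?U"
    using wfE_min[OF wf_ordLess, of _ ?U] by blast
  have "s \<le>o s'" if s': "s' \<in> ?U" for s'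
  proof -
    have "Card_order s" "Card_order s'"
      using s(1) s' by simp_all
    then have w: "Well_order s" "Well_order s'"
      by (simp_all only: card_order_on_well_order_on)
    have "\<not> s' <o s"
    proof
      assume "s' <o s"
      then show False using s(2)[of s'] s' by simp
    qed
    then show ?thesis
      using not_ordLess_iff_ordLeq[OF w] by (rule iffD1[rotated])
  qed
  with s(1) have "is_card_sup (powers_below \<kappa>) s"
    by (auto simp: is_card_sup_def)
  then show ?thesis
    unfolding weak_power_def by (rule someI)
qed

text \<open>
  In the following, \<open>(x, y) \<in> R\<close> means \<open>x \<le> y\<close>, and \<^term>\<open>underS R t\<close> is the
  set of strict predecessors of \<open>t\<close>.
\<close>

definition is_tree :: "'a set \<Rightarrow> 'a rel \<Rightarrow> bool" where
  "is_tree T R \<longleftrightarrow>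
     partial_order_on T R \<and> (\<forall>t\<in>T. well_order_on (underS R t) (Restr R (underS R t)))"

definition is_antichain :: "'a set \<Rightarrow> 'a rel \<Rightarrow> 'a set \<Rightarrow> bool" where
  "is_antichain T R A \<longleftrightarrow> A \<subseteq> T \<and> (\<forall>x\<in>A. \<forall>y\<in>A. x \<noteq> y \<longrightarrow> (x, y) \<notin> R)"

definition special :: "'m rel \<Rightarrow> 'a set \<Rightarrow> 'a rel \<Rightarrow> bool" where
  "special \<mu> T R \<longleftrightarrow>
     (\<exists>\<A>. |\<A>| \<le>o \<mu> \<and> (\<forall>A\<in>\<A>. is_antichain T R A) \<and> T = \<Union>\<A>)"

text \<open>The set \<open>[X]\<^sup>2\<close> of two-element chains in \<open>X\<close>.\<close>

definition chain_pairs :: "'a rel \<Rightarrow> 'a set \<Rightarrow> 'a set set" where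
  "chain_pairs R X = {p. p \<subseteq> X \<and> p \<in> Chains R \<and> card p = 2}"

text \<open>
  The partition relation \<open>T \<rightarrow> (\<alpha>)\<^sup>2\<^sub>k\<close>. Colourings are total functions, of which only the
  values on \<open>[T]\<^sup>2\<close> matter.
\<close>

definition tree_arrow :: "'a set \<Rightarrow> 'a rel \<Rightarrow> 'o rel \<Rightarrow> nat \<Rightarrow> bool" where
  "tree_arrow T R \<alpha> k \<longleftrightarrow>
     (\<forall>c :: 'a set \<Rightarrow> nat. (\<forall>p\<in>chain_pairs R T. c p < k) \<longrightarrow>
        (\<exists>C i. C \<subseteq> T \<and> C \<in> Chains R \<and> Restr R C =o \<alpha> \<and> (\<forall>p\<in>chain_pairs R C. c p = i)))"

end

theory Submission
  imports Defs
begin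

text \<open>
  Send the nodes to pairs \<open>(i, A)\<close> with \<open>i < \<kappa>\<close> and \<open>A \<subseteq> i\<close>, injectively on
  chains: there are \<open>2\<^bsup><\<kappa>\<^esup>\<close> such pairs. As \<open>2\<^bsup><\<kappa>\<^esup> > \<kappa>\<close>, some
  \<open>i\<^sub>0 < \<kappa>\<close> has at least \<open>\<kappa>\<close> subsets, so \<open>\<kappa>\<close> embeds into the power set of
  \<open>i\<^sub>0\<close>. Order the pairs first by the image of \<open>i\<close> in that power set and then by \<open>A\<close>,
  power sets being ordered lexicographically, and apply Sierpinski's colouring: does this order agree
  with that of the tree? A homogeneous chain of type \<open>\<kappa>\<close> yields a monotone
  \<open>\<kappa>\<close>-sequence of pairs, hence by regularity one in the power set of a single
  \<open>i < \<kappa>\<close>, and there is none.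
\<close>

section \<open>Lexicographic order on power sets\<close>

definition lex_less :: "'k rel \<Rightarrow> 'k set \<Rightarrow> 'k set \<Rightarrow> 'k set \<Rightarrow> bool" where
  "lex_less r V A B \<longleftrightarrow> (\<exists>d\<in>V. d \<notin> A \<and> d \<in> B \<and> A \<inter> underS r d = B \<inter> underS r d)"

text \<open>Complements have the same first difference, with the sides swapped. Decreasing sequences
  thus become increasing ones.\<close>

lemma lex_less_Compl: "lex_less r V (- A) (- B) \<longleftrightarrow> lex_less r V B A"
  unfolding lex_less_def by (intro bex_cong) auto

lemma Well_order_underS_cases:
  assumes "Well_order r" "x \<in> Field r" "y \<in> Field r"
  obtains "x = y" | "x \<in> underS r y" | "y \<in> underS r x"
  using assms unfolding well_order_on_def linear_order_on_def total_on_def underS_def by blast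

lemma Well_order_underS_trans:
  assumes "Well_order r" "x \<in> underS r y" "y \<in> underS r z"
  shows "x \<in> underS r z"
  using assms unfolding order_on_defs underS_def trans_def antisym_def
  by blast

lemma Well_order_minimal:
  assumes "Well_order r" "X \<noteq> {}" "X \<subseteq> Field r"
  obtains m where "m \<in> X" "\<And>y. y \<in> X \<Longrightarrow> y = m \<or> m \<in> underS r y"
proof -
  have "wf (r - Id)"
    using assms(1) by (simp add: well_order_on_def)
  then obtain m where m: "m \<in> X" "\<And>y. (y, m) \<in> r - Id \<Longrightarrow> y \<notin> X"
    using assms(2) by (metis wfE_min ex_in_conv)
  have "y = m \<or> m \<in> underS r y" if "y \<in> X" for y
    using Well_order_underS_cases[OF assms(1), of m y] m that assms(3)
    by (auto simp: underS_def)
  with m(1) show ?thesis using that by blast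
qed

text \<open>The least point of the symmetric difference decides; it lies in \<open>V\<close> because
  both sets do.\<close>

lemma lex_less_linear:
  assumes "Well_order r" "V \<subseteq> Field r" "A \<subseteq> V" "B \<subseteq> V" "A \<noteq> B"
  shows "lex_less r V A B \<or> lex_less r V B A"
proof -
  let ?D = "(A - B) \<union> (B - A)"
  have "?D \<noteq> {}" "?D \<subseteq> Field r"
    using assms by auto
  then obtain m where m: "m \<in> ?D" "\<And>y. y \<in> ?D \<Longrightarrow> y = m \<or> m \<in> underS r y"
    by (rule Well_order_minimal[OF assms(1)]) auto
  have "y \<notin> ?D" if "y \<in> underS r m" for y
    using m(2)[of y] that assms(1)
    unfolding order_on_defs underS_def antisym_def by blast
  then have "A \<inter> underS r m = B \<inter> underS r m"
    by auto
  with m(1) assms(3,4) show ?thesis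
    unfolding lex_less_def by auto
qed

section \<open>Increasing sequences of sets\<close>

text \<open>A bounded \<open>X\<close> lies in a proper initial segment, which is smaller than the
  cardinal. The segment ends at some \<open>z\<close> beyond \<open>x\<close>, as \<open>x\<close>
  itself may belong to \<open>X\<close>.\<close>

lemma Card_order_subset_not_bounded:
  assumes r: "Card_order r" "\<not> finite (Field r)" and X: "X \<subseteq> Field r" "\<not> |X| <o r"
    and x: "x \<in> Field r"
  shows "\<exists>y\<in>X. x \<in> underS r y"
proof (rule ccontr)
  assume *: "\<not> ?thesis"
  have w: "Well_order r"
    using r(1) by (rule card_order_on_well_order_on)
  obtain z where z: "z \<in> Field r" "x \<noteq> z" "(x, z) \<in> r"
    using infinite_Card_order_limit[OF r x] by blast
  have "X \<subseteq> underS r z"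
  proof
    fix y assume "y \<in> X"
    with X(1) * have "y = x \<or> y \<in> underS r x"
      using Well_order_underS_cases[OF w, of x y] x by blast
    moreover have "x \<in> underS r z"
      using z by (simp add: underS_def)
    ultimately show "y \<in> underS r z"
      using Well_order_underS_trans[OF w] by blast
  qed
  then have "|X| <o r"
    using card_of_mono1 card_of_underS[OF r(1) z(1)] ordLeq_ordLess_trans by blast
  with X(2) show False by blast
qed

text \<open>
  If \<open>\<delta> x\<close> is the place where \<open>\<phi> x\<close> first differs from the next member of the
  sequence, then on every fibre of \<open>\<delta>\<close> the sequence is increasing already below the value
  of \<open>\<delta>\<close>; by regularity some fibre is large.
\<close>

lemma lex_increasing_small:
  assumes r: "Card_order r" "\<not> finite (Field r)" "regularCard r"
    and "i \<in> Field r" "X \<subseteq> Field r"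
    and "\<And>x y. x \<in> X \<Longrightarrow> y \<in> X \<Longrightarrow> x \<in> underS r y \<Longrightarrow> lex_less r (underS r i) (\<phi> x) (\<phi> y)"
  shows "|X| <o r"
proof -
  have w: "Well_order r"
    using r(1) by (rule card_order_on_well_order_on)
  then have "wf (r - Id)"
    by (simp add: well_order_on_def)
  then show ?thesis
    using assms(4-6)
  proof (induction i arbitrary: X rule: wf_induct_rule)
    case (less i)
    show ?case
    proof (rule ccontr)
      assume large: "\<not> |X| <o r"
      \<comment> \<open>The next member of \<open>X\<close> after \<open>x\<close> exists because a
        large \<open>X\<close> is unbounded.\<close>
      have "\<exists>s\<in>X. x \<in> underS r s \<and> (\<forall>y\<in>X. x \<in> underS r y \<longrightarrow> y = s \<or> s \<in> underS r y)"
        if "x \<in> X" for x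
      proof -
        let ?Y = "{y \<in> X. x \<in> underS r y}"
        have "?Y \<noteq> {}" "?Y \<subseteq> Field r"
          using Card_order_subset_not_bounded[OF r(1,2) less.prems(2) large] that less.prems(2)
          by blast+
        then show ?thesis
          by (rule Well_order_minimal[OF w]) auto
      qed
      then obtain s where s: "\<And>x. x \<in> X \<Longrightarrow> s x \<in> X" "\<And>x. x \<in> X \<Longrightarrow> x \<in> underS r (s x)"
          "\<And>x y. x \<in> X \<Longrightarrow> y \<in> X \<Longrightarrow> x \<in> underS r y \<Longrightarrow> y = s x \<or> s x \<in> underS r y"
        by metis
      have "\<forall>x\<in>X. lex_less r (underS r i) (\<phi> x) (\<phi> (s x))"
        using less.prems(3) s by blast
      then obtain \<delta> where \<delta>: "\<And>x. x \<in> X \<Longrightarrow> \<delta> x \<in> underS r i" "\<And>x. x \<in> X \<Longrightarrow> \<delta> x \<notin> \<phi> x"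
          "\<And>x. x \<in> X \<Longrightarrow> \<delta> x \<in> \<phi> (s x)"
          "\<And>x. x \<in> X \<Longrightarrow> \<phi> x \<inter> underS r (\<delta> x) = \<phi> (s x) \<inter> underS r (\<delta> x)"
        unfolding lex_less_def by metis
      have "|{x \<in> X. \<delta> x = d}| <o r" if d: "d \<in> underS r i" for d
      proof (rule less.IH)
        show "(d, i) \<in> r - Id" "d \<in> Field r"
          using d by (auto simp: underS_def Field_def)
        show "{x \<in> X. \<delta> x = d} \<subseteq> Field r"
          using less.prems(2) by blast
      next
        fix x y
        assume "x \<in> {x \<in> X. \<delta> x = d}" "y \<in> {x \<in> X. \<delta> x = d}" and xy: "x \<in> underS r y"
        then have x: "x \<in> X" "\<delta> x = d" and y: "y \<in> X" "\<delta> y = d"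
          by auto
        have "y \<noteq> s x"
          using \<delta>(2)[OF y(1)] \<delta>(3)[OF x(1)] x y by auto
        then have "s x \<in> underS r y"
          using s(3)[OF x(1) y(1) xy] by blast
        then have "lex_less r (underS r i) (\<phi> (s x)) (\<phi> y)"
          using less.prems(3) s(1) x(1) y(1) by blast
        then obtain e where e: "e \<in> underS r i" "e \<notin> \<phi> (s x)" "e \<in> \<phi> y"
            "\<phi> (s x) \<inter> underS r e = \<phi> y \<inter> underS r e"
          unfolding lex_less_def by blast
        \<comment> \<open>The set \<open>\<phi> (s x)\<close> contains \<open>d\<close> but not
          \<open>e\<close>, and it agrees below \<open>e\<close> with \<open>\<phi> y\<close>, which
          omits \<open>d\<close>. So \<open>e\<close> comes before \<open>d\<close>, where
          \<open>\<phi> x\<close> still agrees with \<open>\<phi> (s x)\<close>; hence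
          \<open>e\<close> is also the first difference of \<open>\<phi> x\<close> and
          \<open>\<phi> y\<close>.\<close>
        have "e \<noteq> d" "d \<notin> underS r e"
          using e \<delta>(2)[OF y(1)] \<delta>(3)[OF x(1)] x y by auto
        then have ed: "e \<in> underS r d"
          using Well_order_underS_cases[OF w, of d e] d e(1) by (auto simp: underS_def Field_def)
        have eq: "\<phi> x \<inter> underS r d = \<phi> (s x) \<inter> underS r d"
          using \<delta>(4)[OF x(1)] x(2) by simp
        have "underS r e \<subseteq> underS r d"
          using Well_order_underS_trans[OF w _ ed] by blast
        with eq e(4) have "\<phi> x \<inter> underS r e = \<phi> y \<inter> underS r e"
          by blast
        moreover have "e \<notin> \<phi> x"
          using e(2) ed eq by blast
        ultimately show "lex_less r (underS r d) (\<phi> x) (\<phi> y)"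
          using ed e(3) unfolding lex_less_def by blast
      qed
      then have "|\<Union>d\<in>underS r i. {x \<in> X. \<delta> x = d}| <o r"
        by (rule stable_UNION[OF regularCard_stable[OF r] card_of_underS[OF r(1) less.prems(1)]])
      moreover have "(\<Union>d\<in>underS r i. {x \<in> X. \<delta> x = d}) = X"
        using \<delta>(1) by auto
      ultimately show False
        using large by simp
    qed
  qed
qed

lemma Card_order_not_small: "Card_order r \<Longrightarrow> \<not> |Field r| <o r"
  using card_of_Field_ordIso not_ordLess_ordIso by blast

text \<open>Fibres of \<open>g\<close> are small because \<open>b\<close> increases on them, and
  they are few because \<open>h\<close> increases along their first points. By regularity they
  cannot cover the field. Arbitrary \<open>h\<close> and \<open>b\<close> leave room for
  complements.\<close>

lemma no_lex_prod_increasing: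
  assumes r: "Card_order r" "\<not> finite (Field r)" "regularCard r"
    and i: "i \<in> Field r" and g: "g ` Field r \<subseteq> Field r"
    and inc: "\<And>x y. y \<in> Field r \<Longrightarrow> x \<in> underS r y \<Longrightarrow>
      lex_less r (underS r i) (h (g x)) (h (g y)) \<or>
      g x = g y \<and> lex_less r (underS r (g x)) (b x) (b y)"
  shows False
proof -
  have w: "Well_order r"
    using r(1) by (rule card_order_on_well_order_on)
  let ?F = "\<lambda>j. {x \<in> Field r. g x = j}"
  \<comment> \<open>The first points of the fibres: \<open>g\<close> is injective here, which
    excludes the second alternative of \<open>inc\<close>.\<close>
  let ?X = "{x \<in> Field r. \<forall>y\<in>underS r x. g y \<noteq> g x}"
  have fibre: "|?F j| <o r" if j: "j \<in> Field r" for j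
  proof (rule lex_increasing_small[OF r j, where \<phi> = b])
    fix x y assume "x \<in> ?F j" "y \<in> ?F j" "x \<in> underS r y"
    moreover have "\<not> lex_less r (underS r i) (h j) (h j)"
      by (auto simp: lex_less_def)
    ultimately show "lex_less r (underS r j) (b x) (b y)"
      using inc[of y x] by auto
  qed auto
  have X: "|?X| <o r"
  proof (rule lex_increasing_small[OF r i, where \<phi> = "\<lambda>x. h (g x)"])
    fix x y assume "x \<in> ?X" "y \<in> ?X" "x \<in> underS r y"
    then show "lex_less r (underS r i) (h (g x)) (h (g y))"
      using inc[of y x] by auto
  qed auto
  have "|\<Union>x\<in>?X. ?F (g x)| <o r"
    using g by (intro stable_UNION[OF regularCard_stable[OF r] X] fibre) auto
  moreover have "(\<Union>x\<in>?X. ?F (g x)) = Field r"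
  proof (intro equalityI subsetI)
    fix x assume x: "x \<in> Field r"
    then have "?F (g x) \<noteq> {}" "?F (g x) \<subseteq> Field r"
      by auto
    then obtain m where m: "m \<in> ?F (g x)" "\<And>y. y \<in> ?F (g x) \<Longrightarrow> y = m \<or> m \<in> underS r y"
      by (rule Well_order_minimal[OF w]) auto
    have "g y \<noteq> g m" if y: "y \<in> underS r m" for y
    proof
      assume "g y = g m"
      then have "y = m \<or> m \<in> underS r y"
        using y m by (auto simp: underS_def Field_def)
      with y w show False
        unfolding order_on_defs underS_def antisym_def by blast
    qed
    then have "m \<in> ?X" "x \<in> ?F (g m)"
      using m(1) x by auto
    then show "x \<in> (\<Union>x\<in>?X. ?F (g x))"
      by blast
  qed auto
  ultimately show False
    using Card_order_not_small[OF r(1)] by simp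
qed

section \<open>The weak power and power sets of initial segments\<close>

text \<open>A cardinal below \<open>r\<close> is isomorphic to some initial segment
  \<open>underS r i\<close>, so its power is bounded by that of the segment.\<close>

lemma powers_below_le_Pow_underS:
  assumes r: "Card_order r" and p: "p \<in> powers_below r"
  obtains i where "i \<in> Field r" "p \<le>o |Pow (underS r i)|"
proof -
  obtain \<mu> :: "'a rel" where \<mu>: "p = ctwo ^c \<mu>" "Card_order \<mu>" "\<mu> <o r"
    using p unfolding powers_below_def by blast
  obtain i where i: "i \<in> Field r" "\<mu> =o Restr r (underS r i)"
    using ordLess_iff_ordIso_Restr[of r \<mu>] \<mu> r card_order_on_well_order_on by blast
  have "|Field \<mu>| \<le>o |Field (Restr r (underS r i))|"
    using i(2) by (intro card_of_mono2 ordIso_imp_ordLeq)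
  also have "|Field (Restr r (underS r i))| \<le>o |underS r i|"
    by (intro card_of_mono1 Field_Restr_subset)
  finally obtain f where "inj_on f (Field \<mu>)" "f ` Field \<mu> \<subseteq> underS r i"
    unfolding card_of_ordLeq[symmetric] by blast
  then have "|Pow (Field \<mu>)| \<le>o |Pow (underS r i)|"
    by (intro card_of_ordLeqI[OF inj_on_image_Pow]) auto
  moreover have "p =o |Pow (Field \<mu>)|"
    unfolding \<mu>(1) cexp_def ctwo_def Field_card_of
    by (rule ordIso_symmetric[OF card_of_Pow_Func])
  ultimately show ?thesis
    using that i(1) ordIso_ordLeq_trans by blast
qed

text \<open>The disjoint union of the power sets bounds every power in the family, hence also their
  supremum.\<close>

lemma weak_power_le_Sigma:
  assumes r: "Card_order r"
  shows "weak_power r \<le>o |SIGMA i:Field r. Pow (underS r i)|"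
proof (rule is_card_sup_least[OF is_card_sup_weak_power card_of_Card_order], rule ballI)
  fix p assume "p \<in> powers_below r"
  then obtain i where i: "i \<in> Field r" "p \<le>o |Pow (underS r i)|"
    by (rule powers_below_le_Pow_underS[OF r])
  have "|Pow (underS r i)| \<le>o |SIGMA i:Field r. Pow (underS r i)|"
    using i(1) by (intro card_of_ordLeqI[of "Pair i"]) (auto simp: inj_on_def)
  with i(2) show "p \<le>o |SIGMA i:Field r. Pow (underS r i)|"
    by (rule ordLeq_transitive)
qed

text \<open>If no initial segment had at least \<open>r\<close> subsets, \<open>r\<close> would
  bound all the powers and hence \<open>weak_power r\<close>.\<close>

lemma ex_inj_Pow_underS:
  assumes r: "Card_order r" and less: "r <o weak_power r"
  obtains i h where "i \<in> Field r" "inj_on h (Field r)" "h ` Field r \<subseteq> Pow (underS r i)"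
proof -
  have "\<exists>i\<in>Field r. r \<le>o |Pow (underS r i)|"
  proof (rule ccontr)
    assume *: "\<not> ?thesis"
    have "weak_power r \<le>o r"
    proof (rule is_card_sup_least[OF is_card_sup_weak_power r], rule ballI)
      fix p assume "p \<in> powers_below r"
      then obtain i where i: "i \<in> Field r" "p \<le>o |Pow (underS r i)|"
        by (rule powers_below_le_Pow_underS[OF r])
      with * have "|Pow (underS r i)| \<le>o r"
        using ordLeq_total card_of_Well_order r card_order_on_well_order_on by blast
      with i(2) show "p \<le>o r"
        by (rule ordLeq_transitive)
    qed
    with less show False
      using not_ordLess_ordLeq by blast
  qed
  then obtain i where i: "i \<in> Field r" "r \<le>o |Pow (underS r i)|"
    by blast
  have "|Field r| \<le>o |Pow (underS r i)|"
    using card_of_Field_ordIso[OF r] i(2) by (rule ordIso_ordLeq_trans)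
  then obtain h where "inj_on h (Field r)" "h ` Field r \<subseteq> Pow (underS r i)"
    unfolding card_of_ordLeq[symmetric] by blast
  with i(1) that show ?thesis by blast
qed

text \<open>Each node gets the code of an antichain containing it, the codes being pairs
  \<open>(i, A)\<close>. Distinct comparable nodes lie in no common antichain, so their codes
  differ.\<close>

lemma special_weak_power_labelling:
  assumes r: "Card_order r" and sp: "special (weak_power r) T R"
  obtains g b where "g ` T \<subseteq> Field r" "\<And>t. t \<in> T \<Longrightarrow> b t \<subseteq> underS r (g t)"
    "\<And>x y. x \<in> T \<Longrightarrow> y \<in> T \<Longrightarrow> (x, y) \<in> R \<Longrightarrow> x \<noteq> y \<Longrightarrow> g x \<noteq> g y \<or> b x \<noteq> b y"
proof -
  obtain \<A> where \<A>: "|\<A>| \<le>o weak_power r" "\<forall>A\<in>\<A>. is_antichain T R A" "T = \<Union>\<A>"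
    using sp unfolding special_def by blast
  have "|\<A>| \<le>o |SIGMA i:Field r. Pow (underS r i)|"
    using \<A>(1) weak_power_le_Sigma[OF r] by (rule ordLeq_transitive)
  then obtain f where f: "inj_on f \<A>" "f ` \<A> \<subseteq> (SIGMA i:Field r. Pow (underS r i))"
    unfolding card_of_ordLeq[symmetric] by blast
  have "\<forall>t\<in>T. \<exists>A\<in>\<A>. t \<in> A"
    using \<A>(3) by blast
  then obtain a where a: "\<And>t. t \<in> T \<Longrightarrow> a t \<in> \<A>" "\<And>t. t \<in> T \<Longrightarrow> t \<in> a t"
    by metis
  have fa: "f (a t) \<in> (SIGMA i:Field r. Pow (underS r i))" if "t \<in> T" for t
    using a(1)[OF that] f(2) by blast
  show ?thesis
  proof (rule that[of "\<lambda>t. fst (f (a t))" "\<lambda>t. snd (f (a t))"])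
    show "(\<lambda>t. fst (f (a t))) ` T \<subseteq> Field r"
      using fa by fastforce
    show "snd (f (a t)) \<subseteq> underS r (fst (f (a t)))" if "t \<in> T" for t
      using fa[OF that] by auto
    show "fst (f (a x)) \<noteq> fst (f (a y)) \<or> snd (f (a x)) \<noteq> snd (f (a y))"
      if xy: "x \<in> T" "y \<in> T" "(x, y) \<in> R" "x \<noteq> y" for x y
    proof -
      have "a x \<noteq> a y"
        using xy a \<A>(2) unfolding is_antichain_def by metis
      then have "f (a x) \<noteq> f (a y)"
        using f(1) a(1) xy(1,2) unfolding inj_on_def by blast
      then show ?thesis
        by (auto simp: prod_eq_iff)
    qed
  qed
qed

section \<open>Sierpinski's colouring and the negative relation\<close>

text \<open>Pairs are coloured by whether \<open>Q\<close> holds from the lower to the upper node;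
  the isomorphism with \<open>\<alpha>\<close> turns a homogeneous chain into an enumeration
  \<open>e\<close>.\<close>

lemma tree_arrow_2_homogeneous:
  fixes Q :: "'a \<Rightarrow> 'a \<Rightarrow> bool"
  assumes arrow: "tree_arrow T R \<alpha> 2" and R: "antisym R"
  obtains e where "e ` Field \<alpha> \<subseteq> T"
    "\<And>x y. x \<in> underS \<alpha> y \<Longrightarrow> (e x, e y) \<in> R \<and> e x \<noteq> e y"
    "(\<forall>x y. x \<in> underS \<alpha> y \<longrightarrow> Q (e x) (e y)) \<or> (\<forall>x y. x \<in> underS \<alpha> y \<longrightarrow> \<not> Q (e x) (e y))"
proof -
  define c :: "'a set \<Rightarrow> nat" where
    "c p = (if \<exists>x y. p = {x, y} \<and> (x, y) \<in> R \<and> x \<noteq> y \<and> Q x y then 0 else 1)" for p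
  \<comment> \<open>Antisymmetry lets an unordered pair determine which node is the lower
    one.\<close>
  have c: "c {x, y} = 0 \<longleftrightarrow> Q x y" if "(x, y) \<in> R" "x \<noteq> y" for x y
    using that R unfolding c_def antisym_def by (auto simp: doubleton_eq_iff)
  have "\<exists>C i. C \<subseteq> T \<and> C \<in> Chains R \<and> Restr R C =o \<alpha> \<and> (\<forall>p\<in>chain_pairs R C. c p = i)"
    using arrow unfolding tree_arrow_def by (elim allE[of _ c] mp) (simp add: c_def)
  then obtain C i where C: "C \<subseteq> T" "C \<in> Chains R" "Restr R C =o \<alpha>"
      "\<forall>p\<in>chain_pairs R C. c p = i"
    by blast
  obtain e where e: "iso \<alpha> (Restr R C) e" "Well_order \<alpha>" "Well_order (Restr R C)"
    using ordIso_symmetric[OF C(3)] unfolding ordIso_def by auto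
  then have bij: "bij_betw e (Field \<alpha>) (Field (Restr R C))"
      and ord: "\<And>x y. (x, y) \<in> \<alpha> \<Longrightarrow> (e x, e y) \<in> Restr R C"
    using iso_iff2[of \<alpha> "Restr R C" e] by (auto simp: Field_def)
  have eC: "e ` Field \<alpha> \<subseteq> C"
    using bij Field_Restr_subset[of R C] by (auto simp: bij_betw_def)
  have lt: "(e x, e y) \<in> R \<and> e x \<noteq> e y" if "x \<in> underS \<alpha> y" for x y
  proof -
    have "(x, y) \<in> \<alpha>" "x \<noteq> y" "x \<in> Field \<alpha>" "y \<in> Field \<alpha>"
      using that by (auto simp: underS_def Field_def)
    then show ?thesis
      using ord bij by (auto simp: bij_betw_def inj_on_def)
  qed
  have hom: "Q (e x) (e y) \<longleftrightarrow> i = 0" if xy: "x \<in> underS \<alpha> y" for x y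
  proof -
    have "x \<in> Field \<alpha>" "y \<in> Field \<alpha>"
      using xy by (auto simp: underS_def Field_def)
    then have "{e x, e y} \<subseteq> C"
      using eC by blast
    moreover from this have "{e x, e y} \<in> Chains R"
      using C(2) unfolding Chains_def by blast
    ultimately have "{e x, e y} \<in> chain_pairs R C"
      using lt[OF xy] by (simp add: chain_pairs_def)
    then show ?thesis
      using C(4) c lt[OF xy] by auto
  qed
  show ?thesis
    using that[of e] eC C(1) lt hom by (metis subset_trans)
qed

theorem theorem5p2:
  fixes \<kappa> :: "'k rel" and T :: "'a set" and R :: "'a rel"
  assumes "Card_order \<kappa>" and "\<not> finite (Field \<kappa>)" and "regularCard \<kappa>"
    and "\<kappa> <o weak_power \<kappa>"
    and "is_tree T R"
    and "special (weak_power \<kappa>) T R"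
  shows "\<not> tree_arrow T R \<kappa> 2"
proof
  assume arrow: "tree_arrow T R \<kappa> 2"
  have w: "Well_order \<kappa>"
    using assms(1) by (rule card_order_on_well_order_on)
  obtain i h where i: "i \<in> Field \<kappa>" and h: "inj_on h (Field \<kappa>)" "h ` Field \<kappa> \<subseteq> Pow (underS \<kappa> i)"
    using assms(1,4) by (rule ex_inj_Pow_underS)
  obtain g b where g: "g ` T \<subseteq> Field \<kappa>" and b: "\<And>t. t \<in> T \<Longrightarrow> b t \<subseteq> underS \<kappa> (g t)"
    and gb: "\<And>x y. x \<in> T \<Longrightarrow> y \<in> T \<Longrightarrow> (x, y) \<in> R \<Longrightarrow> x \<noteq> y \<Longrightarrow> g x \<noteq> g y \<or> b x \<noteq> b y"
    using assms(1,6) by (rule special_weak_power_labelling) blast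
  define Q where "Q x y \<longleftrightarrow> lex_less \<kappa> (underS \<kappa> i) (h (g x)) (h (g y)) \<or>
      g x = g y \<and> lex_less \<kappa> (underS \<kappa> (g x)) (b x) (b y)" for x y
  have hV: "h (g t) \<subseteq> underS \<kappa> i" if "t \<in> T" for t
    using h(2) g that by blast
  \<comment> \<open>Labels of distinct comparable nodes differ, and \<open>h\<close> is injective,
    so one of the two power set orders separates them.\<close>
  have lin: "Q x y \<or> Q y x" if xy: "x \<in> T" "y \<in> T" "(x, y) \<in> R" "x \<noteq> y" for x y
  proof (cases "g x = g y")
    case True
    then have "lex_less \<kappa> (underS \<kappa> (g x)) (b x) (b y) \<or> lex_less \<kappa> (underS \<kappa> (g x)) (b y) (b x)"
      using gb[OF xy] b[OF xy(1)] b[OF xy(2)]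
      by (intro lex_less_linear[OF w]) (auto intro: underS_Field)
    with True show ?thesis
      by (auto simp: Q_def)
  next
    case False
    then have "h (g x) \<noteq> h (g y)"
      using h(1) g xy(1,2) unfolding inj_on_def by blast
    then have "lex_less \<kappa> (underS \<kappa> i) (h (g x)) (h (g y)) \<or>
        lex_less \<kappa> (underS \<kappa> i) (h (g y)) (h (g x))"
      using hV[OF xy(1)] hV[OF xy(2)]
      by (intro lex_less_linear[OF w]) (auto intro: underS_Field)
    then show ?thesis
      by (auto simp: Q_def)
  qed
  have "antisym R"
    using assms(5) by (simp add: is_tree_def partial_order_on_def)
  with arrow obtain e where eT: "e ` Field \<kappa> \<subseteq> T"
    and lt: "\<And>x y. x \<in> underS \<kappa> y \<Longrightarrow> (e x, e y) \<in> R \<and> e x \<noteq> e y"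
    and hom: "(\<forall>x y. x \<in> underS \<kappa> y \<longrightarrow> Q (e x) (e y)) \<or> (\<forall>x y. x \<in> underS \<kappa> y \<longrightarrow> \<not> Q (e x) (e y))"
    by (rule tree_arrow_2_homogeneous[where Q = Q]) blast
  have ge: "(\<lambda>x. g (e x)) ` Field \<kappa> \<subseteq> Field \<kappa>"
    using g eT by auto
  from hom show False
  proof
    assume "\<forall>x y. x \<in> underS \<kappa> y \<longrightarrow> Q (e x) (e y)"
    then show False
      by (intro no_lex_prod_increasing[OF assms(1-3) i ge, where h = h and b = "\<lambda>x. b (e x)"])
        (simp add: Q_def)
  next
    assume neg: "\<forall>x y. x \<in> underS \<kappa> y \<longrightarrow> \<not> Q (e x) (e y)"
    \<comment> \<open>By \<open>lin\<close>, failure of \<open>Q\<close> along the chain means that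
      the labels decrease; complementing \<open>h\<close> and \<open>b\<close> makes them
      increase.\<close>
    have "Q (e y) (e x)" if xy: "x \<in> underS \<kappa> y" for x y
    proof -
      have "x \<in> Field \<kappa>" "y \<in> Field \<kappa>"
        using xy by (auto simp: underS_def Field_def)
      then show ?thesis
        using lin[of "e x" "e y"] lt[OF xy] eT neg xy by blast
    qed
    then show False
      by (intro no_lex_prod_increasing[OF assms(1-3) i ge,
            where h = "\<lambda>j. - h j" and b = "\<lambda>x. - b (e x)"])
        (unfold Q_def lex_less_Compl, metis)
  qed
qed

end
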